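(* Let $A$ be a set of monotonic equality analyses, and let $\to$ and $\to^*$ be the associated one-step saturation relation and its reflexive transitive closure. If $ir_2$ is a normal form of $ir_1$, then any other normal form of $ir_1$ is equal to $ir_2$; that is, every $ir_1$ has at most one normal form.
   Context: An intermediate representation (IR) $ir$ encodes a set of nodes (drawn from some universe of nodes) together with a set of equalities between nodes, and it is determined by these two sets. The partial order $\sqsubseteq$ on IRs is: $ir_1 \sqsubseteq ir_2$ iff the nodes of $ir_1$ are a subset of the nodes of $ir_2$ and the equalities of $ir_1$ are a subset of the equalities of $ir_2$. An equality analysis $a$ is given by a (not necessarily deterministic) relation $ir_1 \xrightarrow{a} ir_2$ on IRs, meaning that $ir_2$ may be produced when $a$ runs on $ir_1$ and adds some nodes/equalities to it (if $a$ chooses to add nothing, $ir_2 = ir_1$). Since analyses only add information, $ir_1 \xrightarrow{a} ir_2$ implies $ir_1 \sqsubseteq ir_2$. An equality analysis $a$ is monotonic iff for all $ir_1, ir_2, ir_1'$: $(ir_1 \sqsubseteq ir_2) \wedge (ir_1 \xrightarrow{a} ir_1') \Rightarrow \exists ir_2'.\,[(ir_2 \xrightarrow{a} ir_2') \wedge (ir_1' \sqsubseteq ir_2')]$. Given a set $A$ of equality analyses, $ir_1 \to ir_2$ holds iff there is $a \in A$ with $ir_1 \xrightarrow{a} ir_2$ and $ir_1 \neq ir_2$. $\to^*$ is the reflexive transitive closure of $\to$. $ir_2$ is a normal form of $ir_1$ if $ir_1 \to^* ir_2$ and there is no $ir_3$ with $ir_2 \to ir_3$. No termination of $\to$ is assumed.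 *)

theory Defs
  imports Main
begin

text \<open>
  The universe of nodes is the type variable \<open>'n\<close>. An IR is a set of nodes together with a set of
  equalities between these nodes. The equalities form an arbitrary relation on the nodes; they are
  not required to be closed under reflexivity, symmetry, transitivity or congruence.
\<close>

typedef 'n ir = "{(N :: 'n set, E :: ('n \<times> 'n) set). E \<subseteq> N \<times> N}"
  morphisms dest_ir mk_ir
  by auto

definition nodes :: "'n ir \<Rightarrow> 'n set" where
  "nodes ir = fst (dest_ir ir)"

definition equalities :: "'n ir \<Rightarrow> ('n \<times> 'n) set" where
  "equalities ir = snd (dest_ir ir)"

lemma ir_eqI:
  assumes "nodes ir1 = nodes ir2" and "equalities ir1 = equalities ir2"
  shows "ir1 = ir2"
  using assms unfolding nodes_def equalities_def
  by (simp add: dest_ir_inject[symmetric] prod_eq_iff)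

definition ir_le :: "'n ir \<Rightarrow> 'n ir \<Rightarrow> bool" (infix "\<sqsubseteq>" 50) where
  "ir1 \<sqsubseteq> ir2 \<longleftrightarrow> nodes ir1 \<subseteq> nodes ir2 \<and> equalities ir1 \<subseteq> equalities ir2"

lemma ir_le_refl: "ir \<sqsubseteq> ir"
  by (simp add: ir_le_def)

lemma ir_le_trans: "ir1 \<sqsubseteq> ir2 \<Longrightarrow> ir2 \<sqsubseteq> ir3 \<Longrightarrow> ir1 \<sqsubseteq> ir3"
  by (auto simp: ir_le_def)

lemma ir_le_antisym: "ir1 \<sqsubseteq> ir2 \<Longrightarrow> ir2 \<sqsubseteq> ir1 \<Longrightarrow> ir1 = ir2"
  by (auto simp: ir_le_def intro!: ir_eqI)

text \<open>Analyses are relations: they may be nondeterministic, and they need not be total.\<close>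

definition equality_analysis :: "('n ir \<Rightarrow> 'n ir \<Rightarrow> bool) \<Rightarrow> bool" where
  "equality_analysis a \<longleftrightarrow> (\<forall>ir1 ir2. a ir1 ir2 \<longrightarrow> ir1 \<sqsubseteq> ir2)"

definition monotonic :: "('n ir \<Rightarrow> 'n ir \<Rightarrow> bool) \<Rightarrow> bool" where
  "monotonic a \<longleftrightarrow>
     (\<forall>ir1 ir2 ir1'. ir1 \<sqsubseteq> ir2 \<and> a ir1 ir1' \<longrightarrow> (\<exists>ir2'. a ir2 ir2' \<and> ir1' \<sqsubseteq> ir2'))"

definition step :: "('n ir \<Rightarrow> 'n ir \<Rightarrow> bool) set \<Rightarrow> 'n ir \<Rightarrow> 'n ir \<Rightarrow> bool" where
  "step A ir1 ir2 \<longleftrightarrow> (\<exists>a\<in>A. a ir1 ir2 \<and> ir1 \<noteq> ir2)"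

definition normal_form :: "('n ir \<Rightarrow> 'n ir \<Rightarrow> bool) set \<Rightarrow> 'n ir \<Rightarrow> 'n ir \<Rightarrow> bool" where
  "normal_form A ir1 ir2 \<longleftrightarrow> (step A)\<^sup>*\<^sup>* ir1 ir2 \<and> (\<nexists>ir3. step A ir2 ir3)"

end

theory Submission
  imports Defs
begin

text \<open>Each step only adds information, so the claim follows by transitivity. It serves to
  place a starting IR below each of its normal forms.\<close>

lemma steps_le:
  assumes "\<And>a. a \<in> A \<Longrightarrow> equality_analysis a"
    and "(step A)\<^sup>*\<^sup>* ir1 ir2"
  shows "ir1 \<sqsubseteq> ir2"
  using assms(2)
proof (induction rule: rtranclp_induct)
  case base
  show ?case by (rule ir_le_refl)
next
  case (step y z)
  from step.hyps(2) assms(1) have "y \<sqsubseteq> z"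
    unfolding step_def equality_analysis_def by blast
  with step.IH show ?case by (rule ir_le_trans)
qed

text \<open>
  Monotonicity transports a step below an irreducible \<open>n\<close> to a step from \<open>n\<close>, which can only
  return \<open>n\<close> itself. Hence an irreducible \<open>n\<close> bounds everything reachable from below it, and two
  normal forms of the same IR bound each other.
\<close>

lemma steps_le_irreducible:
  assumes mono: "\<And>a. a \<in> A \<Longrightarrow> monotonic a"
    and irred: "\<nexists>ir. step A n ir"
    and "ir1 \<sqsubseteq> n"
    and "(step A)\<^sup>*\<^sup>* ir1 ir2"
  shows "ir2 \<sqsubseteq> n"
  using assms(4)
proof (induction rule: rtranclp_induct)
  case base
  show ?case by (rule assms(3))
next
  case (step y z)
  from step.hyps(2) obtain a where a: "a \<in> A" "a y z"
    unfolding step_def by blast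
  with mono step.IH obtain n' where n': "a n n'" "z \<sqsubseteq> n'"
    unfolding monotonic_def by blast
  \<comment> \<open>\<open>step\<close> demands a change, so a result \<open>n'\<close> different
    from \<open>n\<close> would be a step from \<open>n\<close>.\<close>
  with irred a(1) have "n' = n"
    unfolding step_def by blast
  with n'(2) show ?case by simp
qed

theorem mainTheorem1:
  fixes A :: "('n ir \<Rightarrow> 'n ir \<Rightarrow> bool) set"
    and ir1 ir2 ir3 :: "'n ir"
  assumes "\<And>a. a \<in> A \<Longrightarrow> equality_analysis a"
    and "\<And>a. a \<in> A \<Longrightarrow> monotonic a"
    and "normal_form A ir1 ir2"
    and "normal_form A ir1 ir3"
  shows "ir3 = ir2"
proof -
  \<comment> \<open>General in \<open>x\<close> and \<open>y\<close>, so that swapping the two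
    normal forms gives both inequalities for antisymmetry.\<close>
  have le: "y \<sqsubseteq> x" if x: "normal_form A ir1 x" and y: "normal_form A ir1 y" for x y
  proof -
    have "ir1 \<sqsubseteq> x"
      using steps_le[OF assms(1)] x unfolding normal_form_def by blast
    then show ?thesis
      using steps_le_irreducible[OF assms(2)] x y unfolding normal_form_def by blast
  qed
  show ?thesis
    using le[OF assms(3,4)] le[OF assms(4,3)] by (rule ir_le_antisym)
qed

end
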